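(* Let $\overline{Q}$ be an $r$-prover question set that is constructible by conditioning. Then $\overline{Q}$ admits exponential parallel repetition.
   Context: Question sets and games: an $r$-prover question set is a finite nonempty $\overline{Q}\subseteq Q^{(1)}\times\cdots\times Q^{(r)}$ with finite $Q^{(j)}$ such that every element of each $Q^{(j)}$ occurs as a $j$-th coordinate of some tuple of $\overline{Q}$. An $r$-prover game with question set $\overline{Q}$ is $(\overline{Q},\overline{A},V)$, $\overline{A}=A^{(1)}\times\cdots\times A^{(r)}$ finite alphabets, $V:\overline{Q}\times\overline{A}\to\{0,1\}$; its value is the maximum over strategies $\mathcal{S}^{(j)}:Q^{(j)}\to A^{(j)}$ of the probability, over uniform $\overline{q}\in\overline{Q}$, that $V(\overline{q},\mathcal{S}^{(1)}(q^{(1)}),\dots,\mathcal{S}^{(r)}(q^{(r)}))=1$; it is trivial if the value is 1. The $n$-fold repetition $\mathcal{G}^n$ has question set $\overline{Q}^n$ (prover $j$ gets the $n$ $j$-th coordinates), answer alphabets $(A^{(j)})^n$, and accepts iff $V$ accepts in all coordinates. $\omega_{\overline{Q}}(n)$ is the supremum of $\mathrm{val}(\mathcal{G}^n)$ over non-trivial games with question set $\overline{Q}$; $\overline{Q}$ admits exponential parallel repetition if there is $C<1$ with $\omega_{\overline{Q}}(n)\le C^n$ for all $n$. Hypergraph view: $\overline{Q}$ is identified with the $r$-partite $r$-uniform hypergraph with (pairwise disjoint) vertex classes $Q^{(1)},\dots,Q^{(r)}$ and hyperedge set $\overline{Q}$. A homomorphism from $(Q^{(1)},\dots,Q^{(r)},\overline{Q})$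 to $(P^{(1)},\dots,P^{(r)},\overline{P})$ is $f=(f^{(1)},\dots,f^{(r)})$ with $f^{(j)}:Q^{(j)}\to P^{(j)}$ such that $(q^{(1)},\dots,q^{(r)})\in\overline{Q}$ implies $(f^{(1)}(q^{(1)}),\dots,f^{(r)}(q^{(r)}))\in\overline{P}$. For $P^{(j)}\subseteq Q^{(j)}$, the section hypergraph is $(P^{(1)},\dots,P^{(r)},\overline{P})$ with $\overline{P}$ the set of hyperedges of $\overline{Q}$ all of whose vertices lie in $P^{(1)}\cup\dots\cup P^{(r)}$. Constructible by conditioning (defined recursively, up to renaming of vertices): (1) A single hyperedge $(\{q^{(1)}\},\dots,\{q^{(r)}\},\{(q^{(1)},\dots,q^{(r)})\})$ is constructible. (2) Doubling: if $(P^{(1)}\sqcup Q^{(1)},\dots,P^{(r)}\sqcup Q^{(r)},\overline{P})$ is constructible, let $R^{(j)}=\{q': q\in Q^{(j)}\}$ be fresh copies of the vertices of $Q^{(j)}$ (vertices of $P^{(j)}$ are "fixed", of $Q^{(j)}$ "old", of $R^{(j)}$ "new"). For a hyperedge $\overline{q}\in\overline{P}$ not all of whose vertices are fixed, let $\overline{q}'$ be obtained by replacing each of its old vertices by its copy. Then $(P^{(1)}\sqcup Q^{(1)}\sqcup R^{(1)},\dots,P^{(r)}\sqcup Q^{(r)}\sqcup R^{(r)},\overline{P}\cup\{\overline{q}':\overline{q}\in\overline{P}\text{ not all of whose vertices are fixed}\})$ is constructible. (3) Collapse: if $(P^{(1)}\sqcup Q^{(1)},\dots,P^{(r)}\sqcup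 Q^{(r)},\overline{Q})$ is constructible, $(P^{(1)},\dots,P^{(r)},\overline{P})$ is its section hypergraph on the sets $P^{(j)}$, and there is a homomorphism from $\overline{Q}$ to $\overline{P}$ that is the identity on $P^{(1)}\cup\dots\cup P^{(r)}$, then $(P^{(1)},\dots,P^{(r)},\overline{P})$ is constructible. *)

theory Defs
  imports "HOL-Probability.Probability"
begin

text \<open>
  Provers are indexed by a finite type \<open>'p\<close>, so \<open>r\<close> is \<open>CARD('p)\<close>. A tuple
  \<open>(q\<^sup>1, ..., q\<^sup>r)\<close> is a function \<open>'p \<Rightarrow> 'q\<close>, and vertex classes are a
  family \<open>'p \<Rightarrow> 'q set\<close>. A vertex of the hypergraph is an element together with its class
  index, so the classes are disjoint even when the sets \<open>Q i\<close> and \<open>Q j\<close> overlap.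
\<close>

section \<open>Question sets and games\<close>

definition question_set :: "('p::finite \<Rightarrow> 'q set) \<Rightarrow> ('p \<Rightarrow> 'q) set \<Rightarrow> bool" where
  "question_set Q Qs \<longleftrightarrow>
     (\<forall>j. finite (Q j)) \<and> finite Qs \<and> Qs \<noteq> {} \<and>
     (\<forall>q\<in>Qs. \<forall>j. q j \<in> Q j) \<and>
     (\<forall>j. \<forall>x\<in>Q j. \<exists>q\<in>Qs. q j = x)"

text \<open>
  A game consists of a question set \<open>Q\<close>, \<open>Qs\<close>, alphabets \<open>A\<close> and a predicate
  \<open>V q a\<close>, of which only the values for \<open>q \<in> Qs\<close> and \<open>a j \<in> A j\<close> matter.
\<close>

definition alphabets :: "('p::finite \<Rightarrow> 'a set) \<Rightarrow> bool" where
  "alphabets A \<longleftrightarrow> (\<forall>j. finite (A j) \<and> A j \<noteq> {})"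

definition strategies :: "('p::finite \<Rightarrow> 'q set) \<Rightarrow> ('p \<Rightarrow> 'a set) \<Rightarrow> ('p \<Rightarrow> 'q \<Rightarrow> 'a) set" where
  "strategies Q A = (\<Pi>\<^sub>E j\<in>UNIV. Q j \<rightarrow>\<^sub>E A j)"

definition win_prob ::
  "('p::finite \<Rightarrow> 'q) set \<Rightarrow> (('p \<Rightarrow> 'q) \<Rightarrow> ('p \<Rightarrow> 'a) \<Rightarrow> bool) \<Rightarrow> ('p \<Rightarrow> 'q \<Rightarrow> 'a) \<Rightarrow> real" where
  "win_prob Qs V S = measure_pmf.prob (pmf_of_set Qs) {q. V q (\<lambda>j. S j (q j))}"

definition game_value ::
  "('p::finite \<Rightarrow> 'q set) \<Rightarrow> ('p \<Rightarrow> 'q) set \<Rightarrow> ('p \<Rightarrow> 'a set) \<Rightarrow>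
   (('p \<Rightarrow> 'q) \<Rightarrow> ('p \<Rightarrow> 'a) \<Rightarrow> bool) \<Rightarrow> real" where
  "game_value Q Qs A V = Max (win_prob Qs V ` strategies Q A)"

definition trivial_game ::
  "('p::finite \<Rightarrow> 'q set) \<Rightarrow> ('p \<Rightarrow> 'q) set \<Rightarrow> ('p \<Rightarrow> 'a set) \<Rightarrow>
   (('p \<Rightarrow> 'q) \<Rightarrow> ('p \<Rightarrow> 'a) \<Rightarrow> bool) \<Rightarrow> bool" where
  "trivial_game Q Qs A V \<longleftrightarrow> game_value Q Qs A V = 1"

section \<open>Parallel repetition\<close>

definition rep_class :: "nat \<Rightarrow> ('p \<Rightarrow> 'x set) \<Rightarrow> 'p \<Rightarrow> 'x list set" where
  "rep_class n X j = {xs. length xs = n \<and> set xs \<subseteq> X j}"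

text \<open>
  The set of tuples of the \<open>n\<close>-fold repetition, transposed: each prover receives the list of
  its \<open>n\<close> coordinates.
\<close>

definition rep_tuples :: "nat \<Rightarrow> ('p \<Rightarrow> 'q) set \<Rightarrow> ('p \<Rightarrow> 'q list) set" where
  "rep_tuples n Qs = {q. (\<forall>j. length (q j) = n) \<and> (\<forall>i<n. (\<lambda>j. q j ! i) \<in> Qs)}"

definition rep_pred ::
  "nat \<Rightarrow> (('p \<Rightarrow> 'q) \<Rightarrow> ('p \<Rightarrow> 'a) \<Rightarrow> bool) \<Rightarrow> ('p \<Rightarrow> 'q list) \<Rightarrow> ('p \<Rightarrow> 'a list) \<Rightarrow> bool" where
  "rep_pred n V q a \<longleftrightarrow> (\<forall>i<n. V (\<lambda>j. q j ! i) (\<lambda>j. a j ! i))"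

definition rep_value ::
  "nat \<Rightarrow> ('p::finite \<Rightarrow> 'q set) \<Rightarrow> ('p \<Rightarrow> 'q) set \<Rightarrow> ('p \<Rightarrow> 'a set) \<Rightarrow>
   (('p \<Rightarrow> 'q) \<Rightarrow> ('p \<Rightarrow> 'a) \<Rightarrow> bool) \<Rightarrow> real" where
  "rep_value n Q Qs A V =
     game_value (rep_class n Q) (rep_tuples n Qs) (rep_class n A) (rep_pred n V)"

text \<open>
  The alphabets range over finite nonempty sets of natural numbers: up to renaming of answers,
  which does not affect values, this covers all games with question set \<open>Qs\<close>. The supremum is
  over a nonempty set of numbers in \<open>[0, 1]\<close> if \<open>Qs\<close> is a question set.
\<close>

definition rep_sup :: "('p::finite \<Rightarrow> 'q set) \<Rightarrow> ('p \<Rightarrow> 'q) set \<Rightarrow> nat \<Rightarrow> real" where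
  "rep_sup Q Qs n =
     Sup {rep_value n Q Qs A V | (A :: 'p \<Rightarrow> nat set) V.
            alphabets A \<and> \<not> trivial_game Q Qs A V}"

definition admits_exponential_repetition ::
  "('p::finite \<Rightarrow> 'q set) \<Rightarrow> ('p \<Rightarrow> 'q) set \<Rightarrow> bool" where
  "admits_exponential_repetition Q Qs \<longleftrightarrow> (\<exists>C<1. \<forall>n. rep_sup Q Qs n \<le> C ^ n)"

section \<open>Constructibility by conditioning\<close>

definition map_tuple :: "('p \<Rightarrow> 'v \<Rightarrow> 'w) \<Rightarrow> ('p \<Rightarrow> 'v) \<Rightarrow> 'p \<Rightarrow> 'w" where
  "map_tuple f e = (\<lambda>j. f j (e j))"

definition hypergraph_hom ::
  "('p \<Rightarrow> 'v set) \<Rightarrow> ('p \<Rightarrow> 'v) set \<Rightarrow> ('p \<Rightarrow> 'w set) \<Rightarrow> ('p \<Rightarrow> 'w) set \<Rightarrow>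
   ('p \<Rightarrow> 'v \<Rightarrow> 'w) \<Rightarrow> bool" where
  "hypergraph_hom X E Y F f \<longleftrightarrow>
     (\<forall>j. f j ` X j \<subseteq> Y j) \<and> (\<forall>e\<in>E. map_tuple f e \<in> F)"

definition section_edges :: "('p \<Rightarrow> 'v set) \<Rightarrow> ('p \<Rightarrow> 'v) set \<Rightarrow> ('p \<Rightarrow> 'v) set" where
  "section_edges P E = {e\<in>E. \<forall>j. e j \<in> P j}"

definition copy_edge ::
  "('p \<Rightarrow> 'v set) \<Rightarrow> ('p \<Rightarrow> 'v \<Rightarrow> 'v) \<Rightarrow> ('p \<Rightarrow> 'v) \<Rightarrow> 'p \<Rightarrow> 'v" where
  "copy_edge Q c e = (\<lambda>j. if e j \<in> Q j then c j (e j) else e j)"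

text \<open>
  Intermediate hypergraphs may need more vertices than the type of the final one provides, so
  the recursion takes place on hypergraphs with natural numbers as vertices. In \<open>doubling\<close>,
  \<open>P\<close> are the fixed and \<open>Q\<close> the old vertices, and \<open>c\<close> maps old vertices to their
  copies.
\<close>

inductive constructible_nat :: "('p \<Rightarrow> nat set) \<Rightarrow> ('p \<Rightarrow> nat) set \<Rightarrow> bool" where
  single: "constructible_nat (\<lambda>j. {q j}) {q}"
| doubling: "constructible_nat (\<lambda>j. P j \<union> Q j \<union> c j ` Q j)
               (E \<union> copy_edge Q c ` {e\<in>E. \<not> (\<forall>j. e j \<in> P j)})"
    if "constructible_nat (\<lambda>j. P j \<union> Q j) E"
      and "\<And>j. P j \<inter> Q j = {}"
      and "\<And>j. inj_on (c j) (Q j)"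
      and "\<And>j. c j ` Q j \<inter> (P j \<union> Q j) = {}"
| collapse: "constructible_nat P (section_edges P E)"
    if "constructible_nat (\<lambda>j. P j \<union> Q j) E"
      and "\<And>j. P j \<inter> Q j = {}"
      and "hypergraph_hom (\<lambda>j. P j \<union> Q j) E P (section_edges P E) f"
      and "\<And>j v. v \<in> P j \<Longrightarrow> f j v = v"
| renaming: "constructible_nat (\<lambda>j. f j ` X j) (map_tuple f ` E)"
    if "constructible_nat X E"
      and "\<And>j. inj_on (f j) (X j)"

definition constructible_by_conditioning ::
  "('p \<Rightarrow> 'v set) \<Rightarrow> ('p \<Rightarrow> 'v) set \<Rightarrow> bool" where
  "constructible_by_conditioning X E \<longleftrightarrow>
     (\<exists>f. (\<forall>j. inj_on (f j) (X j)) \<and>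
          constructible_nat (\<lambda>j. f j ` X j) (map_tuple f ` E))"

end

theory Submission
  imports Defs
begin

text \<open>
  Following the construction of a hypergraph \<open>H\<close>, one builds a random map from \<open>H\<close> to
  \<open>Qs\<close> which takes every homomorphism as a value with positive probability and whose
  independent \<open>n\<close>-fold product satisfies a Sidorenko-type bound: if a uniform tuple of the
  \<open>n\<close>-fold repetition lies in \<open>T\<close> with probability \<open>\<epsilon>\<close>, then all edges of \<open>H\<close> are
  mapped into \<open>T\<close> with probability at least \<open>\<epsilon> ^ k\<close>, where \<open>k\<close> depends only on
  \<open>H\<close>. Doubling resamples the old vertices conditionally on the fixed ones and squares the bound
  by Cauchy-Schwarz; collapse restricts the map, and the homomorphism in its hypothesis is what
  lets every homomorphism from the smaller hypergraph extend. Now let \<open>H = Qs\<close>, and let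
  \<open>p > 0\<close> be the probability of the identity. If \<open>T\<close> is the set of tuples won by some
  strategy for the repetition and \<open>\<epsilon> ^ k > (1 - p) ^ n\<close>, then some copy of \<open>Qs\<close> inside
  \<open>T\<close> is the identity in one of its coordinates, and playing that coordinate wins the original
  game with certainty. For a non-trivial game therefore \<open>\<epsilon> \<le> root k (1 - p) ^ n\<close>.
\<close>

section \<open>Conditioning and products of probability mass functions\<close>

lemma measure_bind_pmf:
  "measure (bind_pmf M N) A = (\<integral>x. measure (N x) A \<partial>M)"
proof -
  have int: "integrable M (\<lambda>x. measure (N x) A)"
    by (rule measure_pmf.integrable_const_bound[where B = 1]) auto
  have "ennreal (measure (bind_pmf M N) A) = (\<integral>\<^sup>+x. ennreal (measure (N x) A) \<partial>M)"
    by (simp flip: measure_pmf.emeasure_eq_measure)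
  also have "\<dots> = ennreal (\<integral>x. measure (N x) A \<partial>M)"
    by (intro nn_integral_eq_integral int) auto
  finally show ?thesis by simp
qed

lemma measure_pair_pmf_Times:
  "measure (pair_pmf M N) (A \<times> B) = measure M A * measure N B"
proof -
  have "measure (pair_pmf M N) (A \<times> B) = (\<integral>x. (\<integral>y. indicator A x * indicator B y \<partial>N) \<partial>M)"
    by (simp add: pair_pmf_def measure_bind_pmf indicator_times)
  also have "\<dots> = measure M A * measure N B"
    by simp
  finally show ?thesis .
qed

text \<open>Cauchy-Schwarz, in the form that a variance is nonnegative: given \<open>x\<close>, the
  two draws are independent, so both fall into \<open>G\<close> with probability the second moment
  of \<open>measure (L x) G\<close>.\<close>

lemma measure_bind_pair_pmf_ge:
  "(measure (bind_pmf M L) G)\<^sup>2 \<le> measure (bind_pmf M (\<lambda>x. pair_pmf (L x) (L x))) (G \<times> G)"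
proof -
  let ?g = "\<lambda>x. measure (L x) G"
  have int: "integrable M ?g" "integrable M (\<lambda>x. (?g x)\<^sup>2)"
    by (rule measure_pmf.integrable_const_bound[where B = 1]; simp add: power_le_one)+
  have "0 \<le> (\<integral>x. (?g x)\<^sup>2 \<partial>M) - (\<integral>x. ?g x \<partial>M)\<^sup>2"
    using measure_pmf.variance_positive[of M ?g] by (simp only: measure_pmf.variance_eq[OF int])
  then show ?thesis
    by (simp add: measure_bind_pmf measure_pair_pmf_Times power2_eq_square)
qed

lemma Pi_pmf_pair:
  assumes "finite I"
  shows "Pi_pmf I (d, d') (\<lambda>i. pair_pmf (p i) (q i)) =
    map_pmf (\<lambda>(f, g) i. (f i, g i)) (pair_pmf (Pi_pmf I d p) (Pi_pmf I d' q))"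
proof -
  have "Pi_pmf I (d, d') (\<lambda>i. pair_pmf (p i) (q i)) =
    Pi_pmf I d p \<bind> (\<lambda>f. Pi_pmf I d' q \<bind> (\<lambda>g.
      return_pmf (\<lambda>i. if i \<in> I then (f i, g i) else (d, d'))))"
    unfolding pair_pmf_def
    by (simp add: Pi_pmf_bind[OF assms, where d' = d] Pi_pmf_bind[OF assms, where d' = d']
        Pi_pmf_return_pmf assms)
  \<comment> \<open>Outside \<open>I\<close> every function in the supports takes the default value,
    so the case distinction disappears.\<close>
  also have "\<dots> = Pi_pmf I d p \<bind> (\<lambda>f. Pi_pmf I d' q \<bind> (\<lambda>g. return_pmf (\<lambda>i. (f i, g i))))"
    by (intro bind_pmf_cong refl arg_cong[where f = return_pmf])
      (auto simp: fun_eq_iff dest!: subsetD[OF set_Pi_pmf_subset[OF assms]])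
  finally show ?thesis
    by (simp add: pair_pmf_def map_bind_pmf)
qed

text \<open>Law of total probability over the value of \<open>f\<close>: resampling a point within
  its fibre leaves its distribution unchanged.\<close>

lemma bind_cond_pmf_fibre:
  "bind_pmf M (\<lambda>x. cond_pmf M {y. f x = f y}) = M"
  by (rule bind_cond_pmf_cancel) (auto simp: eq_commute)


section \<open>Random maps into the question set\<close>

definition covers_homs ::
  "('p \<Rightarrow> 'q) set \<Rightarrow> ('p \<Rightarrow> 'v set) \<Rightarrow> ('p \<Rightarrow> 'v) set \<Rightarrow> ('p \<Rightarrow> 'v \<Rightarrow> 'q) pmf \<Rightarrow> bool" where
  "covers_homs Qs X E M \<longleftrightarrow>
     (\<forall>h. (\<forall>e\<in>E. map_tuple h e \<in> Qs) \<longrightarrow> (\<exists>h'\<in>set_pmf M. \<forall>j. \<forall>v\<in>X j. h' j v = h j v))"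

lemma covers_homsD:
  assumes "covers_homs Qs X E M" "\<And>e. e \<in> E \<Longrightarrow> map_tuple h e \<in> Qs"
  shows "\<exists>h'\<in>set_pmf M. \<forall>j. \<forall>v\<in>X j. h' j v = h j v"
  using assms unfolding covers_homs_def by blast

text \<open>\<open>h i\<close> is the copy of the hypergraph in coordinate \<open>i\<close>, so an
  edge yields one sequence of \<open>n\<close> tuples. \<open>T\<close> need not be a product set,
  and the exponent is fixed before \<open>n\<close> and \<open>T\<close>.\<close>

definition power_bounded ::
  "('p \<Rightarrow> 'q) set \<Rightarrow> ('p \<Rightarrow> 'v) set \<Rightarrow> nat \<Rightarrow> ('p \<Rightarrow> 'v \<Rightarrow> 'q) pmf \<Rightarrow> bool" where
  "power_bounded Qs E c M \<longleftrightarrow>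
     (\<forall>(n::nat) T. measure (Pi_pmf {..<n} (\<lambda>_. undefined) (\<lambda>_. pmf_of_set Qs)) T ^ c
        \<le> measure (Pi_pmf {..<n} (\<lambda>_ _. undefined) (\<lambda>_. M))
             {h. \<forall>e\<in>E. (\<lambda>i. map_tuple (h i) e) \<in> T})"

lemma covers_homs_single:
  assumes "finite Qs" "Qs \<noteq> {}"
  shows "covers_homs Qs (\<lambda>j. {q j}) {q} (map_pmf (\<lambda>x j _. x j) (pmf_of_set Qs))"
  using assms by (auto simp: covers_homs_def map_tuple_def)

text \<open>The only edge is mapped to the uniform tuple \<open>x\<close> itself, so exponent 1
  holds with equality.\<close>

lemma power_bounded_single:
  fixes Qs :: "('p \<Rightarrow> 'q) set" and q :: "'p \<Rightarrow> 'v"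
  shows "power_bounded Qs {q} 1 (map_pmf (\<lambda>x j _. x j) (pmf_of_set Qs))"
proof -
  let ?f = "(\<lambda>x j _. x j) :: ('p \<Rightarrow> 'q) \<Rightarrow> 'p \<Rightarrow> 'v \<Rightarrow> 'q"
  have "Pi_pmf {..<n} (\<lambda>_ _. undefined) (\<lambda>_. map_pmf ?f (pmf_of_set Qs)) =
      map_pmf (\<lambda>h. ?f \<circ> h) (Pi_pmf {..<n} (\<lambda>_. undefined) (\<lambda>_. pmf_of_set Qs))" for n :: nat
    by (rule Pi_pmf_map) auto
  then show ?thesis
    by (simp add: power_bounded_def vimage_def map_tuple_def)
qed

section \<open>Doubling\<close>

text \<open>
  In the doubled hypergraph, \<open>h\<close> gives the values at the fixed and old vertices and \<open>h'\<close> those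
  at the new ones.
\<close>

definition glue ::
  "('p \<Rightarrow> 'v set) \<Rightarrow> ('p \<Rightarrow> 'v \<Rightarrow> 'v) \<Rightarrow> ('p \<Rightarrow> 'v \<Rightarrow> 'q) \<Rightarrow> ('p \<Rightarrow> 'v \<Rightarrow> 'q) \<Rightarrow> 'p \<Rightarrow> 'v \<Rightarrow> 'q" where
  "glue Q c h h' = (\<lambda>j v. if v \<in> c j ` Q j then h' j (inv_into (Q j) (c j) v) else h j v)"

text \<open>\<open>restrict\<close> turns agreement on the fixed vertices into equality of
  functions, so that the fibres are those of a map, as in
  \<open>bind_cond_pmf_fibre\<close>.\<close>

definition fibre_pmf ::
  "('p \<Rightarrow> 'v set) \<Rightarrow> ('p \<Rightarrow> 'v \<Rightarrow> 'q) pmf \<Rightarrow> ('p \<Rightarrow> 'v \<Rightarrow> 'q) \<Rightarrow> ('p \<Rightarrow> 'v \<Rightarrow> 'q) pmf" where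
  "fibre_pmf P M x = cond_pmf M {y. (\<lambda>j. restrict (x j) (P j)) = (\<lambda>j. restrict (y j) (P j))}"

text \<open>Both halves are drawn afresh given \<open>x\<close>. Each then has law \<open>M\<close>,
  and the probability that both satisfy an event is a second moment.\<close>

definition doubled_pmf ::
  "('p \<Rightarrow> 'v set) \<Rightarrow> ('p \<Rightarrow> 'v set) \<Rightarrow> ('p \<Rightarrow> 'v \<Rightarrow> 'v) \<Rightarrow> ('p \<Rightarrow> 'v \<Rightarrow> 'q) pmf
    \<Rightarrow> ('p \<Rightarrow> 'v \<Rightarrow> 'q) pmf" where
  "doubled_pmf P Q c M =
     map_pmf (\<lambda>(h, h'). glue Q c h h') (M \<bind> (\<lambda>x. pair_pmf (fibre_pmf P M x) (fibre_pmf P M x)))"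

lemma bind_fibre_pmf: "M \<bind> fibre_pmf P M = M"
  unfolding fibre_pmf_def by (rule bind_cond_pmf_fibre)

lemma set_fibre_pmf:
  assumes "x \<in> set_pmf M"
  shows "set_pmf (fibre_pmf P M x) = {y \<in> set_pmf M. \<forall>j. \<forall>v\<in>P j. y j v = x j v}"
proof -
  have "(\<lambda>j. restrict (x j) (P j)) = (\<lambda>j. restrict (y j) (P j)) \<longleftrightarrow> (\<forall>j. \<forall>v\<in>P j. y j v = x j v)" for y
    by (simp add: fun_eq_iff restrict_def) metis
  moreover have "set_pmf M \<inter> {y. (\<lambda>j. restrict (x j) (P j)) = (\<lambda>j. restrict (y j) (P j))} \<noteq> {}"
    using assms by auto
  ultimately show ?thesis
    unfolding fibre_pmf_def by (subst set_cond_pmf) auto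
qed

context
  fixes P Q :: "'p \<Rightarrow> 'v set" and c :: "'p \<Rightarrow> 'v \<Rightarrow> 'v" and E :: "('p \<Rightarrow> 'v) set"
  assumes edges: "\<And>e j. e \<in> E \<Longrightarrow> e j \<in> P j \<union> Q j"
    and disj: "\<And>j. P j \<inter> Q j = {}"
    and inj: "\<And>j. inj_on (c j) (Q j)"
    and fresh: "\<And>j. c j ` Q j \<inter> (P j \<union> Q j) = {}"
begin

lemma map_tuple_glue:
  assumes "e \<in> E"
  shows "map_tuple (glue Q c h h') e = map_tuple h e"
  using edges[OF assms] fresh by (fastforce simp: map_tuple_def glue_def)

text \<open>Old vertices become copies, where \<open>glue\<close> reads \<open>h'\<close>; fixed
  vertices stay and are read from \<open>h\<close>, which agrees with \<open>h'\<close>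
  there.\<close>

lemma map_tuple_glue_copy_edge:
  assumes "e \<in> E" "\<And>j v. v \<in> P j \<Longrightarrow> h j v = h' j v"
  shows "map_tuple (glue Q c h h') (copy_edge Q c e) = map_tuple h' e"
proof
  fix j
  consider "e j \<in> Q j" | "e j \<in> P j" "e j \<notin> Q j" "e j \<notin> c j ` Q j"
    using edges[OF assms(1), of j] fresh[of j] by blast
  then show "map_tuple (glue Q c h h') (copy_edge Q c e) j = map_tuple h' e j"
    by cases (auto simp: map_tuple_def glue_def copy_edge_def assms(2) inv_into_f_f[OF inj])
qed

text \<open>A homomorphism from the doubled hypergraph amounts to two homomorphisms from the
  original one that agree on the fixed vertices: \<open>h\<close> itself, and its pullback
  \<open>h2\<close> along the copying.\<close>

lemma covers_homs_doubled:
  assumes M: "covers_homs Qs (\<lambda>j. P j \<union> Q j) E M"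
  shows "covers_homs Qs (\<lambda>j. P j \<union> Q j \<union> c j ` Q j)
    (E \<union> copy_edge Q c ` {e\<in>E. \<not> (\<forall>j. e j \<in> P j)}) (doubled_pmf P Q c M)"
  unfolding covers_homs_def
proof (intro allI impI)
  fix h
  assume h: "\<forall>e\<in>E \<union> copy_edge Q c ` {e\<in>E. \<not> (\<forall>j. e j \<in> P j)}. map_tuple h e \<in> Qs"
  define h2 where "h2 j v = (if v \<in> Q j then h j (c j v) else h j v)" for j v
  have h2: "map_tuple h2 e \<in> Qs" if "e \<in> E" for e
  proof -
    have eq: "map_tuple h2 e = map_tuple h (copy_edge Q c e)"
      by (auto simp: map_tuple_def h2_def copy_edge_def)
    show ?thesis
    proof (cases "\<forall>j. e j \<in> P j")
      case True
      \<comment> \<open>Doubling adds no copy of a completely fixed edge, but such an edge is its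
        own copy.\<close>
      then have "copy_edge Q c e = e"
        using disj by (fastforce simp: copy_edge_def)
      then show ?thesis using eq h that by auto
    next
      case False
      then show ?thesis using eq h that by auto
    qed
  qed
  obtain y2 where y2: "y2 \<in> set_pmf M" "\<And>j v. v \<in> P j \<union> Q j \<Longrightarrow> y2 j v = h2 j v"
    using covers_homsD[OF M h2] by blast
  obtain y1 where y1: "y1 \<in> set_pmf M" "\<And>j v. v \<in> P j \<union> Q j \<Longrightarrow> y1 j v = h j v"
    using covers_homsD[OF M, of h] h by blast
  have "y1 j v = y2 j v" if "v \<in> P j" for j v
    using that disj[of j] y1(2)[of v j] y2(2)[of v j] by (auto simp: h2_def)
  \<comment> \<open>Agreement on \<open>P\<close> puts both maps into the fibre of
    \<open>y1\<close>, so taking \<open>x = y1\<close> gives the pair positive probability.\<close>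
  then have "y1 \<in> set_pmf (fibre_pmf P M y1)" "y2 \<in> set_pmf (fibre_pmf P M y1)"
    using y1(1) y2(1) by (auto simp: set_fibre_pmf)
  then have "glue Q c y1 y2 \<in> set_pmf (doubled_pmf P Q c M)"
    using y1(1) by (force simp: doubled_pmf_def)
  moreover have "glue Q c y1 y2 j v = h j v" if "v \<in> P j \<union> Q j \<union> c j ` Q j" for j v
  proof (cases "v \<in> c j ` Q j")
    case True
    then obtain u where "u \<in> Q j" "v = c j u" by auto
    then show ?thesis
      using y2(2)[of u j] by (simp add: glue_def h2_def inv_into_f_f[OF inj])
  next
    case False
    then show ?thesis using that y1(2) by (simp add: glue_def)
  qed
  ultimately show "\<exists>h'\<in>set_pmf (doubled_pmf P Q c M).
      \<forall>j. \<forall>v\<in>P j \<union> Q j \<union> c j ` Q j. h' j v = h j v"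
    by blast
qed

lemma power_bounded_doubled:
  fixes M :: "('p \<Rightarrow> 'v \<Rightarrow> 'q) pmf"
  assumes M: "power_bounded Qs E k M"
  shows "power_bounded Qs (E \<union> copy_edge Q c ` {e\<in>E. \<not> (\<forall>j. e j \<in> P j)}) (2 * k)
    (doubled_pmf P Q c M)"
  unfolding power_bounded_def
proof (intro allI)
  fix n :: nat and T :: "(nat \<Rightarrow> 'p \<Rightarrow> 'q) set"
  let ?E' = "E \<union> copy_edge Q c ` {e\<in>E. \<not> (\<forall>j. e j \<in> P j)}"
  let ?d = "\<lambda>_ _. undefined"
  let ?event = "\<lambda>E :: ('p \<Rightarrow> 'v) set. {h. \<forall>e\<in>E. (\<lambda>i. map_tuple (h i) e) \<in> T}"
  let ?G = "?event E"
  let ?M = "Pi_pmf {..<n} ?d (\<lambda>_. M)"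
  define L where "L x = Pi_pmf {..<n} ?d (\<lambda>i. fibre_pmf P M (x i))" for x
  \<comment> \<open>Resampling each coordinate within its own fibre preserves the product
    law.\<close>
  have bind: "?M \<bind> L = ?M"
    using Pi_pmf_bind[of "{..<n}" ?d "\<lambda>_. M" "\<lambda>_. fibre_pmf P M" ?d]
    by (simp add: bind_fibre_pmf L_def[abs_def])
  \<comment> \<open>\<open>glue\<close> sends the pair of defaults to the default, as
    \<open>Pi_pmf_map\<close> requires.\<close>
  have "Pi_pmf {..<n} ?d (\<lambda>_. doubled_pmf P Q c M) =
    map_pmf (\<lambda>h. (\<lambda>(h, h'). glue Q c h h') \<circ> h) (Pi_pmf {..<n} (?d, ?d)
      (\<lambda>_. M \<bind> (\<lambda>x. pair_pmf (fibre_pmf P M x) (fibre_pmf P M x))))"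
    unfolding doubled_pmf_def by (rule Pi_pmf_map) (auto simp: glue_def fun_eq_iff)
  also have "Pi_pmf {..<n} (?d, ?d)
      (\<lambda>_. M \<bind> (\<lambda>x. pair_pmf (fibre_pmf P M x) (fibre_pmf P M x))) =
    map_pmf (\<lambda>(f, g) i. (f i, g i)) (?M \<bind> (\<lambda>x. pair_pmf (L x) (L x)))"
    by (simp add: Pi_pmf_bind[where d' = ?d] Pi_pmf_pair L_def map_bind_pmf)
  finally have eq: "Pi_pmf {..<n} ?d (\<lambda>_. doubled_pmf P Q c M) =
    map_pmf (\<lambda>(f, g) i. glue Q c (f i) (g i)) (?M \<bind> (\<lambda>x. pair_pmf (L x) (L x)))"
    by (simp add: pmf.map_comp o_def case_prod_unfold)
  have mem: "(\<lambda>i. glue Q c (f i) (g i)) \<in> ?event ?E'"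
    if x: "x \<in> set_pmf ?M" and f: "f \<in> set_pmf (L x)" "f \<in> ?G" and g: "g \<in> set_pmf (L x)" "g \<in> ?G"
    for x f g
  proof -
    have agree: "f i j v = g i j v" if "v \<in> P j" for i j v
    proof (cases "i < n")
      case True
      then have "x i \<in> set_pmf M"
        "f i \<in> set_pmf (fibre_pmf P M (x i))" "g i \<in> set_pmf (fibre_pmf P M (x i))"
        using x f(1) g(1) by (auto simp: L_def set_Pi_pmf PiE_dflt_def)
      then show ?thesis using that by (auto simp: set_fibre_pmf)
    next
      case False
      then show ?thesis
        using f(1) g(1) by (auto simp: L_def set_Pi_pmf PiE_dflt_def)
    qed
    have "(\<lambda>i. map_tuple (glue Q c (f i) (g i)) e) = (\<lambda>i. map_tuple (f i) e)" if "e \<in> E" for e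
      using that by (simp add: map_tuple_glue)
    moreover have "(\<lambda>i. map_tuple (glue Q c (f i) (g i)) (copy_edge Q c e)) = (\<lambda>i. map_tuple (g i) e)"
      if "e \<in> E" for e
      using that agree by (simp add: map_tuple_glue_copy_edge)
    ultimately show ?thesis
      using f(2) g(2) by auto
  qed
  have "measure (Pi_pmf {..<n} (\<lambda>_. undefined) (\<lambda>_. pmf_of_set Qs)) T ^ (2 * k)
      \<le> (measure ?M ?G)\<^sup>2"
    using M unfolding power_bounded_def
    by (simp add: power_mult mult.commute[of 2 k] power_mono)
  also have "\<dots> = (measure (bind_pmf ?M L) ?G)\<^sup>2"
    by (simp add: bind)
  also have "\<dots> \<le> measure (bind_pmf ?M (\<lambda>x. pair_pmf (L x) (L x))) (?G \<times> ?G)"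
    by (rule measure_bind_pair_pmf_ge)
  \<comment> \<open>The inclusion is claimed only almost everywhere: \<open>f\<close> and
    \<open>g\<close> are known to agree on the fixed vertices only within the support.\<close>
  also have "\<dots> \<le> measure (bind_pmf ?M (\<lambda>x. pair_pmf (L x) (L x)))
      ((\<lambda>(f, g) i. glue Q c (f i) (g i)) -` ?event ?E')"
    by (rule measure_pmf.finite_measure_mono_AE)
      (use mem in \<open>auto simp: AE_measure_pmf_iff\<close>)
  also have "\<dots> = measure (Pi_pmf {..<n} ?d (\<lambda>_. doubled_pmf P Q c M)) (?event ?E')"
    by (simp add: eq)
  finally show "measure (Pi_pmf {..<n} (\<lambda>_. undefined) (\<lambda>_. pmf_of_set Qs)) T ^ (2 * k)
      \<le> measure (Pi_pmf {..<n} ?d (\<lambda>_. doubled_pmf P Q c M)) (?event ?E')" .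
qed

end

section \<open>Collapse and renaming\<close>

text \<open>\<open>f\<close> is a retraction onto the section, so composing with it extends a
  homomorphism from the section to all of \<open>E\<close>.\<close>

lemma covers_homs_collapse:
  assumes M: "covers_homs Qs (\<lambda>j. P j \<union> Q j) E M"
    and f: "hypergraph_hom (\<lambda>j. P j \<union> Q j) E P (section_edges P E) f"
    and id: "\<And>j v. v \<in> P j \<Longrightarrow> f j v = v"
  shows "covers_homs Qs P (section_edges P E) M"
  unfolding covers_homs_def
proof (intro allI impI)
  fix h
  assume h: "\<forall>e\<in>section_edges P E. map_tuple h e \<in> Qs"
  have "map_tuple (\<lambda>j v. h j (f j v)) e = map_tuple h (map_tuple f e)" for e
    by (simp add: map_tuple_def)
  with h f have *: "map_tuple (\<lambda>j v. h j (f j v)) e \<in> Qs" if "e \<in> E" for e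
    using that by (simp add: hypergraph_hom_def)
  obtain h' where "h' \<in> set_pmf M" "\<And>j v. v \<in> P j \<union> Q j \<Longrightarrow> h' j v = h j (f j v)"
    using covers_homsD[OF M *] by blast
  then show "\<exists>h'\<in>set_pmf M. \<forall>j. \<forall>v\<in>P j. h' j v = h j v"
    using id by (metis UnI1)
qed

text \<open>A collapse keeps the random map \<open>M\<close>; having fewer edges only enlarges the
  event.\<close>

lemma power_bounded_mono:
  assumes M: "power_bounded Qs E k M" and "F \<subseteq> E"
  shows "power_bounded Qs F k M"
  unfolding power_bounded_def
proof (intro allI)
  fix n :: nat and T
  have "measure (Pi_pmf {..<n} (\<lambda>_ _. undefined) (\<lambda>_. M)) {h. \<forall>e\<in>E. (\<lambda>i. map_tuple (h i) e) \<in> T}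
    \<le> measure (Pi_pmf {..<n} (\<lambda>_ _. undefined) (\<lambda>_. M)) {h. \<forall>e\<in>F. (\<lambda>i. map_tuple (h i) e) \<in> T}"
    by (rule measure_pmf.finite_measure_mono) (use assms(2) in auto)
  with M show "measure (Pi_pmf {..<n} (\<lambda>_. undefined) (\<lambda>_. pmf_of_set Qs)) T ^ k
    \<le> measure (Pi_pmf {..<n} (\<lambda>_ _. undefined) (\<lambda>_. M)) {h. \<forall>e\<in>F. (\<lambda>i. map_tuple (h i) e) \<in> T}"
    unfolding power_bounded_def by (meson order_trans)
qed

definition rename_hom ::
  "('p \<Rightarrow> 'v set) \<Rightarrow> ('p \<Rightarrow> 'v \<Rightarrow> 'w) \<Rightarrow> ('p \<Rightarrow> 'v \<Rightarrow> 'q) \<Rightarrow> 'p \<Rightarrow> 'w \<Rightarrow> 'q" where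
  "rename_hom X f h = (\<lambda>j v. h j (inv_into (X j) (f j) v))"

lemma covers_homs_renaming:
  assumes M: "covers_homs Qs X E M" and inj: "\<And>j. inj_on (f j) (X j)"
  shows "covers_homs Qs (\<lambda>j. f j ` X j) (map_tuple f ` E) (map_pmf (rename_hom X f) M)"
  unfolding covers_homs_def
proof (intro allI impI)
  fix h
  assume h: "\<forall>e\<in>map_tuple f ` E. map_tuple h e \<in> Qs"
  have "map_tuple (\<lambda>j v. h j (f j v)) e = map_tuple h (map_tuple f e)" for e
    by (simp add: map_tuple_def)
  with h have *: "map_tuple (\<lambda>j v. h j (f j v)) e \<in> Qs" if "e \<in> E" for e
    using that by simp
  obtain h' where "h' \<in> set_pmf M" "\<And>j v. v \<in> X j \<Longrightarrow> h' j v = h j (f j v)"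
    using covers_homsD[OF M *] by blast
  then show "\<exists>h'\<in>set_pmf (map_pmf (rename_hom X f) M). \<forall>j. \<forall>v\<in>f j ` X j. h' j v = h j v"
    by (auto simp: rename_hom_def inv_into_f_f[OF inj] intro!: bexI[of _ h'])
qed

lemma power_bounded_renaming:
  fixes M :: "('p \<Rightarrow> 'v \<Rightarrow> 'q) pmf"
  assumes M: "power_bounded Qs E k M" and inj: "\<And>j. inj_on (f j) (X j)"
    and edges: "\<And>e j. e \<in> E \<Longrightarrow> e j \<in> X j"
  shows "power_bounded Qs (map_tuple f ` E) k (map_pmf (rename_hom X f) M)"
proof -
  have "Pi_pmf {..<n} (\<lambda>_ _. undefined) (\<lambda>_. map_pmf (rename_hom X f) M) =
      map_pmf (\<lambda>h. rename_hom X f \<circ> h) (Pi_pmf {..<n} (\<lambda>_ _. undefined) (\<lambda>_. M))" for n :: nat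
    by (rule Pi_pmf_map) (auto simp: rename_hom_def)
  moreover have "map_tuple (rename_hom X f h) (map_tuple f e) = map_tuple h e" if "e \<in> E"
    for h :: "'p \<Rightarrow> 'v \<Rightarrow> 'q" and e
    using edges[OF that] by (simp add: map_tuple_def rename_hom_def inv_into_f_f[OF inj])
  ultimately show ?thesis
    using M by (simp add: power_bounded_def vimage_def cong: ball_cong)
qed

section \<open>Induction over the construction\<close>

lemma constructible_nat_edges:
  assumes "constructible_nat X E" "e \<in> E"
  shows "e j \<in> X j"
  using assms
proof (induction arbitrary: e j rule: constructible_nat.induct)
  case (doubling P Q E c)
  then consider "e \<in> E" | e' where "e' \<in> E" "e = copy_edge Q c e'"
    by blast
  then show ?case
  proof cases
    case 1
    then show ?thesis using doubling.IH[of e j] by blast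
  next
    case 2
    then show ?thesis using doubling.IH[of e' j] by (auto simp: copy_edge_def)
  qed
qed (auto simp: section_edges_def map_tuple_def)

text \<open>The exponent starts at 1, doubles with each doubling and is kept by collapse and
  renaming. The target \<open>Qs\<close> stays fixed throughout the induction.\<close>

lemma constructible_nat_random_hom:
  fixes Qs :: "('p::finite \<Rightarrow> 'q) set"
  assumes "constructible_nat X E" and Qs: "finite Qs" "Qs \<noteq> {}"
  obtains k M where "0 < k" "covers_homs Qs X E M" "power_bounded Qs E k M"
proof -
  have "\<exists>k M. 0 < k \<and> covers_homs Qs X E M \<and> power_bounded Qs E k M"
    using assms(1)
  proof (induction rule: constructible_nat.induct)
    case (single q)
    then show ?case
      using covers_homs_single[OF Qs] power_bounded_single zero_less_one by blast
  next
    case (doubling P Q E c)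
    from doubling.IH obtain k M
      where M: "0 < k" "covers_homs Qs (\<lambda>j. P j \<union> Q j) E M" "power_bounded Qs E k M"
      by blast
    note * = constructible_nat_edges[OF doubling.hyps(1)] doubling.hyps(2-4)
    have "0 < 2 * k" using M(1) by simp
    moreover have "covers_homs Qs (\<lambda>j. P j \<union> Q j \<union> c j ` Q j)
        (E \<union> copy_edge Q c ` {e\<in>E. \<not> (\<forall>j. e j \<in> P j)}) (doubled_pmf P Q c M)"
      by (intro covers_homs_doubled * M(2))
    moreover have "power_bounded Qs (E \<union> copy_edge Q c ` {e\<in>E. \<not> (\<forall>j. e j \<in> P j)}) (2 * k)
        (doubled_pmf P Q c M)"
      by (intro power_bounded_doubled * M(3))
    ultimately show ?case by blast
  next
    case (collapse P Q E f)
    then obtain k M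
      where M: "0 < k" "covers_homs Qs (\<lambda>j. P j \<union> Q j) E M" "power_bounded Qs E k M"
      by blast
    have "section_edges P E \<subseteq> E"
      by (auto simp: section_edges_def)
    with M(1) covers_homs_collapse[OF M(2) collapse.hyps(3,4)] power_bounded_mono[OF M(3)]
    show ?case by blast
  next
    case (renaming X E f)
    then obtain k M where M: "0 < k" "covers_homs Qs X E M" "power_bounded Qs E k M"
      by blast
    have "power_bounded Qs (map_tuple f ` E) k (map_pmf (rename_hom X f) M)"
      by (rule power_bounded_renaming[OF M(3)])
        (rule renaming.hyps(2), rule constructible_nat_edges[OF renaming.hyps(1)])
    with M(1) covers_homs_renaming[OF M(2) renaming.hyps(2)] show ?case
      by (intro exI conjI)
  qed
  then show ?thesis using that by blast
qed

section \<open>Uniform tuples, strategies and trivial games\<close>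

lemma pmf_of_rep_tuples:
  fixes Qs :: "('p::finite \<Rightarrow> 'q) set"
  assumes "finite Qs" "Qs \<noteq> {}"
  shows "pmf_of_set (rep_tuples n Qs) =
    map_pmf (\<lambda>t j. map (\<lambda>i. t i j) [0..<n]) (Pi_pmf {..<n} (\<lambda>_. undefined) (\<lambda>_. pmf_of_set Qs))"
proof -
  let ?d = "\<lambda>_ :: 'p. undefined :: 'q"
  let ?B = "PiE_dflt {..<n} ?d (\<lambda>_. Qs)"
  have "bij_betw (\<lambda>t j. map (\<lambda>i. t i j) [0..<n]) ?B (rep_tuples n Qs)"
  \<comment> \<open>The inverse transposes back and returns the default from index \<open>n\<close>
    on, as membership in \<open>PiE_dflt\<close> demands.\<close>
  proof (rule bij_betw_byWitness[where f' = "\<lambda>q i. if i < n then (\<lambda>j. q j ! i) else ?d"])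
    show "\<forall>t\<in>?B. (\<lambda>i. if i < n then (\<lambda>j. map (\<lambda>i. t i j) [0..<n] ! i) else ?d) = t"
      by (auto simp: PiE_dflt_def fun_eq_iff)
    show "\<forall>q\<in>rep_tuples n Qs.
        (\<lambda>j. map (\<lambda>i. (if i < n then (\<lambda>j. q j ! i) else ?d) j) [0..<n]) = q"
      by (auto simp: rep_tuples_def fun_eq_iff intro!: nth_equalityI)
  qed (auto simp: PiE_dflt_def rep_tuples_def)
  moreover have "?B \<noteq> {}" "finite ?B"
    using assms by (auto simp: PiE_dflt_empty_iff intro!: finite_PiE_dflt)
  ultimately show ?thesis
    by (simp add: Pi_pmf_of_set assms map_pmf_of_set_bij_betw)
qed

lemma finite_strategies:
  assumes "\<And>j. finite (Q j)" "\<And>j. finite (A j)"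
  shows "finite (strategies Q A)"
  using assms by (auto simp: strategies_def intro!: finite_PiE)

lemma strategies_nonempty:
  assumes "\<And>j. A j \<noteq> {}"
  shows "strategies Q A \<noteq> {}"
  using assms by (auto simp: strategies_def PiE_eq_empty_iff)

lemma finite_rep_class:
  assumes "finite (X j)"
  shows "finite (rep_class n X j)"
  using finite_lists_length_eq[OF assms, of n] by (simp add: rep_class_def conj_commute)

lemma rep_class_nonempty:
  assumes "X j \<noteq> {}"
  shows "rep_class n X j \<noteq> {}"
proof -
  obtain x where "x \<in> X j" using assms by blast
  then have "replicate n x \<in> rep_class n X j" by (auto simp: rep_class_def)
  then show ?thesis by blast
qed

lemma trivial_gameI:
  assumes Q: "question_set Q Qs" and A: "alphabets A"
    and S: "S \<in> strategies Q A" and win: "\<And>q. q \<in> Qs \<Longrightarrow> V q (\<lambda>j. S j (q j))"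
  shows "trivial_game Q Qs A V"
proof -
  have "win_prob Qs V S = 1"
    using Q win unfolding win_prob_def question_set_def
    by (subst measure_pmf.prob_eq_1) (auto simp: AE_measure_pmf_iff)
  moreover have "win_prob Qs V T \<le> 1" for T
    by (simp add: win_prob_def)
  moreover have "finite (strategies Q A)"
    using Q A by (intro finite_strategies) (auto simp: question_set_def alphabets_def)
  ultimately show ?thesis
    using S unfolding trivial_game_def game_value_def
    by (intro Max_eqI) (auto intro: rev_image_eqI)
qed

text \<open>The game that always rejects shows that the supremum in \<open>rep_sup\<close> is over a
  nonempty set.\<close>

lemma ex_nontrivial_game:
  fixes Q :: "'p::finite \<Rightarrow> 'q set"
  assumes "question_set Q Qs"
  shows "\<exists>(A :: 'p \<Rightarrow> nat set) V. alphabets A \<and> \<not> trivial_game Q Qs A V"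
proof -
  let ?A = "\<lambda>_ :: 'p. {0 :: nat}" and ?V = "\<lambda>_ _. False"
  have "win_prob Qs ?V ` strategies Q ?A = {0}"
    using strategies_nonempty[of ?A Q] by (auto simp: win_prob_def)
  then have "\<not> trivial_game Q Qs ?A ?V"
    by (simp add: trivial_game_def game_value_def)
  moreover have "alphabets ?A"
    by (simp add: alphabets_def)
  ultimately show ?thesis by blast
qed

section \<open>From a winning copy to a perfect strategy\<close>

text \<open>From its own question \<open>v\<close> alone, prover \<open>j\<close> can compute the
  list of images of \<open>v\<close> under all \<open>h k\<close>, ask \<open>S\<close>, and answer
  with entry \<open>i\<close>. Since \<open>h i\<close> is the identity, coordinate \<open>i\<close>
  is the original game.\<close>

lemma trivial_game_of_copy:
  fixes Q :: "'p::finite \<Rightarrow> 'q set" and h :: "nat \<Rightarrow> 'p \<Rightarrow> 'q \<Rightarrow> 'q"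
  assumes Q: "question_set Q Qs" and A: "alphabets A"
    and S: "S \<in> strategies (rep_class n Q) (rep_class n A)"
    and copy: "\<And>e k. e \<in> Qs \<Longrightarrow> k < n \<Longrightarrow> map_tuple (h k) e \<in> Qs"
    and win: "\<And>e. e \<in> Qs \<Longrightarrow> rep_pred n V (\<lambda>j. map (\<lambda>k. h k j (e j)) [0..<n])
        (\<lambda>j. S j (map (\<lambda>k. h k j (e j)) [0..<n]))"
    and i: "i < n" "\<And>j v. v \<in> Q j \<Longrightarrow> h i j v = v"
  shows "trivial_game Q Qs A V"
proof -
  define x where "x j v = map (\<lambda>k. h k j v) [0..<n]" for j v
  have x: "x j v \<in> rep_class n Q j" if v: "v \<in> Q j" for j v
  proof -
    \<comment> \<open>Only edges are known to be mapped into \<open>Qs\<close>, so \<open>v\<close>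
      is first placed on an edge.\<close>
    obtain e where e: "e \<in> Qs" "e j = v"
      using Q v unfolding question_set_def by blast
    have "h k j v \<in> Q j" if "k < n" for k
    proof -
      have "map_tuple (h k) e j \<in> Q j"
        using copy[OF e(1) that] Q unfolding question_set_def by blast
      then show ?thesis by (simp add: map_tuple_def e(2))
    qed
    then show ?thesis by (auto simp: x_def rep_class_def)
  qed
  define T where "T j = (\<lambda>v\<in>Q j. S j (x j v) ! i)" for j
  have "S j (x j v) \<in> rep_class n A j" if "v \<in> Q j" for j v
    using S x[OF that] by (auto simp: strategies_def PiE_iff)
  then have "S j (x j v) ! i \<in> A j" if "v \<in> Q j" for j v
    using that i(1) by (force simp: rep_class_def)
  then have "T \<in> strategies Q A"
    by (auto simp: strategies_def T_def)
  moreover have "V e (\<lambda>j. T j (e j))" if e: "e \<in> Qs" for e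
  proof -
    have "e j \<in> Q j" for j using Q e unfolding question_set_def by blast
    then have "(\<lambda>j. h i j (e j)) = e" "T j (e j) = S j (x j (e j)) ! i" for j
      using i(2) by (auto simp: T_def)
    moreover have "V (\<lambda>j. x j (e j) ! i) (\<lambda>j. S j (x j (e j)) ! i)"
      using win[OF e] i(1) by (simp add: rep_pred_def x_def)
    ultimately show ?thesis
      using i(1) by (simp add: x_def)
  qed
  ultimately show ?thesis
    by (rule trivial_gameI[OF Q A])
qed

lemma win_prob_power_le:
  fixes Q :: "'p::finite \<Rightarrow> 'q set" and M :: "('p \<Rightarrow> 'q \<Rightarrow> 'q) pmf"
  assumes Q: "question_set Q Qs" and A: "alphabets A" and nontriv: "\<not> trivial_game Q Qs A V"
    and S: "S \<in> strategies (rep_class n Q) (rep_class n A)"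
    and M: "power_bounded Qs Qs k M"
  shows "win_prob (rep_tuples n Qs) (rep_pred n V) S ^ k
    \<le> (1 - measure M {h. \<forall>j. \<forall>v\<in>Q j. h j v = v}) ^ n"
proof -
  let ?N = "Pi_pmf {..<n} (\<lambda>_. undefined) (\<lambda>_. pmf_of_set Qs)"
  let ?K = "Pi_pmf {..<n} (\<lambda>_ _. undefined) (\<lambda>_. M)"
  let ?I = "{h. \<forall>j. \<forall>v\<in>Q j. h j v = v}"
  let ?t = "\<lambda>t j. map (\<lambda>i. t i j) [0..<n]"
  \<comment> \<open>Requiring \<open>t i \<in> Qs\<close> costs no probability and ensures that the
    copies consist of tuples of \<open>Qs\<close>.\<close>
  define W where "W = {t. (\<forall>i<n. t i \<in> Qs) \<and> rep_pred n V (?t t) (\<lambda>j. S j (?t t j))}"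
  have Qs: "finite Qs" "Qs \<noteq> {}"
    using Q by (auto simp: question_set_def)
  have "win_prob (rep_tuples n Qs) (rep_pred n V) S =
      measure ?N {t. rep_pred n V (?t t) (\<lambda>j. S j (?t t j))}"
    by (simp add: win_prob_def pmf_of_rep_tuples[OF Qs] vimage_def)
  also have "\<dots> = measure ?N W"
    by (rule measure_pmf.finite_measure_eq_AE)
      (auto simp: AE_measure_pmf_iff W_def set_Pi_pmf PiE_dflt_def Qs)
  finally have "win_prob (rep_tuples n Qs) (rep_pred n V) S ^ k
      \<le> measure ?K {h. \<forall>e\<in>Qs. (\<lambda>i. map_tuple (h i) e) \<in> W}"
    using M by (simp add: power_bounded_def)
  \<comment> \<open>If some coordinate were the identity on \<open>Q\<close>, the copy would make
    the game trivial. Independence of the coordinates then gives the \<open>n\<close>-th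
    power.\<close>
  also have "\<dots> \<le> measure ?K (Pi {..<n} (\<lambda>_. - ?I))"
  proof (rule measure_pmf.finite_measure_mono)
    show "{h. \<forall>e\<in>Qs. (\<lambda>i. map_tuple (h i) e) \<in> W} \<subseteq> Pi {..<n} (\<lambda>_. - ?I)"
    proof (intro subsetI Pi_I ComplI)
      fix h i
      assume h: "h \<in> {h. \<forall>e\<in>Qs. (\<lambda>i. map_tuple (h i) e) \<in> W}" and i: "i \<in> {..<n}" "h i \<in> ?I"
      have "trivial_game Q Qs A V"
        by (rule trivial_game_of_copy[OF Q A S, of h V i])
          (use h i in \<open>auto simp: W_def map_tuple_def\<close>)
      with nontriv show False by blast
    qed
  qed simp
  also have "\<dots> = (1 - measure M ?I) ^ n"
    by (simp add: measure_Pi_pmf_Pi measure_pmf.prob_compl[of ?I M, simplified] Compl_eq_Diff_UNIV)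
  finally show ?thesis .
qed

section \<open>Exponential decay\<close>

text \<open>The random map lives on the hypergraph with natural numbers as vertices; renaming along
  the inverse of \<open>f\<close> brings it back to the original vertex type.\<close>

lemma constructible_by_conditioning_random_hom:
  fixes Q :: "'p::finite \<Rightarrow> 'q set"
  assumes Q: "question_set Q Qs" and "constructible_by_conditioning Q Qs"
  obtains k M where "0 < k" "covers_homs Qs Q Qs M" "power_bounded Qs Qs k M"
proof -
  obtain f where inj: "\<And>j. inj_on (f j) (Q j)"
    and con: "constructible_nat (\<lambda>j. f j ` Q j) (map_tuple f ` Qs)"
    using assms(2) unfolding constructible_by_conditioning_def by blast
  have Qs: "finite Qs" "Qs \<noteq> {}" "\<And>e j. e \<in> Qs \<Longrightarrow> e j \<in> Q j"
    using Q by (auto simp: question_set_def)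
  define g where "g j = inv_into (Q j) (f j)" for j
  have gf: "g j (f j v) = v" if "v \<in> Q j" for j v
    using that by (simp add: g_def inv_into_f_f[OF inj])
  have inj_g: "inj_on (g j) (f j ` Q j)" for j
    by (simp add: g_def inj_on_inv_into)
  obtain k M where M: "0 < k" "covers_homs Qs (\<lambda>j. f j ` Q j) (map_tuple f ` Qs) M"
    "power_bounded Qs (map_tuple f ` Qs) k M"
    by (rule constructible_nat_random_hom[OF con Qs(1,2)])
  let ?M = "map_pmf (rename_hom (\<lambda>j. f j ` Q j) g) M"
  have image: "(\<lambda>j. g j ` f j ` Q j) = Q"
    using gf by (force simp: fun_eq_iff)
  have "map_tuple g (map_tuple f e) = e" if "e \<in> Qs" for e
    using gf Qs(3)[OF that] by (simp add: map_tuple_def)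
  then have tuples: "map_tuple g ` map_tuple f ` Qs = Qs"
    by force
  have "covers_homs Qs Q Qs ?M"
    using covers_homs_renaming[OF M(2) inj_g] by (simp only: image tuples)
  moreover have "power_bounded Qs (map_tuple g ` map_tuple f ` Qs) k ?M"
    by (rule power_bounded_renaming[OF M(3)]) (rule inj_g, rule constructible_nat_edges[OF con])
  ultimately show ?thesis
    using that M(1) by (simp only: tuples)
qed

theorem theorem1p10:
  fixes Q :: "'p::finite \<Rightarrow> 'q set" and Qs :: "('p \<Rightarrow> 'q) set"
  assumes "question_set Q Qs"
    and "constructible_by_conditioning Q Qs"
  shows "admits_exponential_repetition Q Qs"
proof -
  obtain k M where k: "0 < k" and M: "covers_homs Qs Q Qs M" "power_bounded Qs Qs k M"
    by (rule constructible_by_conditioning_random_hom[OF assms])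
  \<comment> \<open>\<open>k\<close> and \<open>M\<close> are chosen before any game, so the base
    \<open>root k (1 - p)\<close> serves all games at once.\<close>
  define p where "p = measure M {h. \<forall>j. \<forall>v\<in>Q j. h j v = v}"
  \<comment> \<open>The identity is a homomorphism from \<open>Qs\<close> to itself, hence covered
    by \<open>M\<close>.\<close>
  obtain h where "h \<in> set_pmf M" "\<And>j v. v \<in> Q j \<Longrightarrow> h j v = v"
    using covers_homsD[OF M(1), of "\<lambda>_ v. v"] by (auto simp: map_tuple_def)
  then have p: "0 < p" "p \<le> 1"
    unfolding p_def by (auto intro: measure_pmf_posI)
  have "rep_value n Q Qs A V \<le> root k (1 - p) ^ n"
    if A: "alphabets A" "\<not> trivial_game Q Qs A V" for n and A :: "'p \<Rightarrow> nat set" and V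
  proof -
    let ?St = "strategies (rep_class n Q) (rep_class n A)"
    have fin: "finite (Q j)" "finite (A j)" "A j \<noteq> {}" for j
      using assms(1) A(1) by (auto simp: question_set_def alphabets_def)
    have "win_prob (rep_tuples n Qs) (rep_pred n V) S \<le> root k (1 - p) ^ n" if "S \<in> ?St" for S
    proof -
      have "root k (win_prob (rep_tuples n Qs) (rep_pred n V) S ^ k) \<le> root k ((1 - p) ^ n)"
        using win_prob_power_le[OF assms(1) A that M(2)] k by (simp add: p_def)
      then show ?thesis
        using k by (simp add: real_root_power_cancel real_root_power win_prob_def)
    qed
    moreover have "finite ?St" "?St \<noteq> {}"
      using fin by (auto intro!: finite_strategies strategies_nonempty finite_rep_class
          simp: rep_class_nonempty)
    ultimately show ?thesis
      by (simp add: rep_value_def game_value_def)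
  qed
  then have "rep_sup Q Qs n \<le> root k (1 - p) ^ n" for n
    unfolding rep_sup_def using ex_nontrivial_game[OF assms(1)]
    by (intro cSup_least) blast+
  moreover have "root k (1 - p) < 1"
    using k p by simp
  ultimately show ?thesis
    unfolding admits_exponential_repetition_def by blast
qed

end
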